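(* Suppose $g,h\to\infty$ and all variance components $\sigma_\alpha^2,\sigma_\beta^2,\sigma_\gamma^2,\sigma_e^2$ are bounded. Then $$\mathbf V^{-1}=\frac1{\sigma_e^2}\mathbf I_n-\frac{\sigma_\gamma^2}{\sigma_e^2}\operatorname{diag}\Bigl[\frac{1}{\sigma_e^2+m_{ij}\sigma_\gamma^2}\mathbf J_{m_{ij}}\Bigr]+\mathbf O_{[n:n]}\!\left(\frac{1}{\min(g^{1-\varepsilon},h^{1-\varepsilon})\,m_L^2}\right)$$ for some $0\le\varepsilon<1$. Moreover, when $\sigma_e^2/(2m_L^2\sigma_\gamma^2)\le 1$, or when all cell sizes are equal ($m_{ij}=m$ for all $i,j$), this holds with $\varepsilon=0$.
   Context: Setting. For integers $g,h\ge1$ and integer cell sizes $m_{ij}\ge 1$ ($1\le i\le g$, $1\le j\le h$), let $n=\sum_{i,j}m_{ij}$ and $m_L=\min_{i,j}m_{ij}$. The $n$ observations are indexed by triples $(i,j,k)$, $1\le k\le m_{ij}$, in lexicographic order, and $n\times n$ matrices are partitioned into $gh\times gh$ blocks indexed by pairs of cells. The variance components $\sigma_\alpha^2,\sigma_\beta^2,\sigma_\gamma^2\ge0$, $\sigma_e^2>0$ are parameters of the two-way crossed random effects model with interaction, $y_{ijk}=\mu(\mathbf x_{ijk})+\alpha_i+\beta_j+\gamma_{ij}+e_{ijk}$, whose covariance matrix $\mathbf V$ is the $n\times n$ matrix with entries $$\mathbf V_{(i,j,k),(i',j',k')}=\sigma_\alpha^2\mathbb 1[i=i']+\sigma_\beta^2\mathbb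 1[j=j']+\sigma_\gamma^2\mathbb 1[(i,j)=(i',j')]+\sigma_e^2\mathbb 1[(i,j,k)=(i',j',k')].$$ Notation. $\mathbf J_a$ is the $a\times a$ all-ones matrix; $\operatorname{diag}[\mathbf A_{ij}]$ is the $n\times n$ block-diagonal matrix with diagonal blocks $\mathbf A_{ij}$ ($m_{ij}\times m_{ij}$), cells in lexicographic order. $\mathbf O_{[n:n]}(a)$ denotes an $n\times n$ matrix all of whose entries are $O(a)$, uniformly over entries, in the limit. Asymptotic setting. $g,h\to\infty$ with the variance components fixed parameters; $m_L$ is finite (or may diverge to infinity).
   Formalization: It is additionally assumed that σ_γ² > 0 or that m_L stays bounded; for σ_γ² = 0 with m_L → ∞ the claim fails, e.g. σ_α², σ_β² > 0, g = h, all m_ij = g², where diagonal remainder entries are of order 1/(g·m). *)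

theory Defs
  imports "HOL-Analysis.Analysis" "Jordan_Normal_Form.Gauss_Jordan_Elimination"
begin

text \<open>
  A design consists of \<open>g\<close> rows, \<open>h\<close> columns and cell sizes \<open>m i j\<close> with \<open>i < g\<close>, \<open>j < h\<close>;
  all indices start at 0, and values of \<open>m\<close> outside this range are irrelevant.
\<close>

definition num_obs :: "nat \<Rightarrow> nat \<Rightarrow> (nat \<Rightarrow> nat \<Rightarrow> nat) \<Rightarrow> nat" where
  "num_obs g h m = (\<Sum>i<g. \<Sum>j<h. m i j)"

definition min_cell :: "nat \<Rightarrow> nat \<Rightarrow> (nat \<Rightarrow> nat \<Rightarrow> nat) \<Rightarrow> nat" where
  "min_cell g h m = Min ((\<lambda>(i, j). m i j) ` ({..<g} \<times> {..<h}))"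

text \<open>Cells and observations, both listed in lexicographic order.\<close>

definition cells :: "nat \<Rightarrow> nat \<Rightarrow> (nat \<times> nat) list" where
  "cells g h = [(i, j). i \<leftarrow> [0..<g], j \<leftarrow> [0..<h]]"

definition obs :: "nat \<Rightarrow> nat \<Rightarrow> (nat \<Rightarrow> nat \<Rightarrow> nat) \<Rightarrow> (nat \<times> nat \<times> nat) list" where
  "obs g h m = [(i, j, k). i \<leftarrow> [0..<g], j \<leftarrow> [0..<h], k \<leftarrow> [0..<m i j]]"

lemma length_obs: "length (obs g h m) = num_obs g h m"
  by (simp add: obs_def num_obs_def length_concat comp_def interv_sum_list_conv_sum_set_nat
      atLeast0LessThan)

text \<open>
  The arguments \<open>va\<close>, \<open>vb\<close>, \<open>vg\<close>, \<open>ve\<close> are the variance components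
  \<open>\<sigma>\<^sub>\<alpha>\<^sup>2\<close>, \<open>\<sigma>\<^sub>\<beta>\<^sup>2\<close>, \<open>\<sigma>\<^sub>\<gamma>\<^sup>2\<close>, \<open>\<sigma>\<^sub>e\<^sup>2\<close> themselves, not standard deviations.
\<close>

fun obs_cov :: "real \<Rightarrow> real \<Rightarrow> real \<Rightarrow> real \<Rightarrow> nat \<times> nat \<times> nat \<Rightarrow> nat \<times> nat \<times> nat \<Rightarrow> real" where
  "obs_cov va vb vg ve (i, j, k) (i', j', k') =
     va * of_bool (i = i') + vb * of_bool (j = j') + vg * of_bool ((i, j) = (i', j'))
     + ve * of_bool ((i, j, k) = (i', j', k'))"

definition cov_mat ::
  "real \<Rightarrow> real \<Rightarrow> real \<Rightarrow> real \<Rightarrow> nat \<Rightarrow> nat \<Rightarrow> (nat \<Rightarrow> nat \<Rightarrow> nat) \<Rightarrow> real mat" where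
  "cov_mat va vb vg ve g h m =
     mat (num_obs g h m) (num_obs g h m)
       (\<lambda>(r, s). obs_cov va vb vg ve (obs g h m ! r) (obs g h m ! s))"

definition ones_mat :: "nat \<Rightarrow> real mat" where
  "ones_mat a = mat a a (\<lambda>_. 1)"

definition inv_leading :: "real \<Rightarrow> real \<Rightarrow> nat \<Rightarrow> nat \<Rightarrow> (nat \<Rightarrow> nat \<Rightarrow> nat) \<Rightarrow> real mat" where
  "inv_leading vg ve g h m =
     (1 / ve) \<cdot>\<^sub>m 1\<^sub>m (num_obs g h m)
     - (vg / ve) \<cdot>\<^sub>m diag_block_mat
         (map (\<lambda>(i, j). (1 / (ve + real (m i j) * vg)) \<cdot>\<^sub>m ones_mat (m i j)) (cells g h))"

text \<open>
  Families of \<open>n d \<times> n d\<close> matrices, indexed by \<open>d\<close>, whose entries are \<open>O(a d)\<close> along the filter \<open>F\<close>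
  uniformly over the entries: neither the constant nor the exceptional set of \<open>d\<close> depends on the
  position \<open>(r, s)\<close>.
\<close>

definition bigo_mat :: "'d filter \<Rightarrow> ('d \<Rightarrow> nat) \<Rightarrow> ('d \<Rightarrow> real) \<Rightarrow> ('d \<Rightarrow> real mat) set" where
  "bigo_mat F n a =
     {R. \<exists>C. \<forall>\<^sub>F d in F. R d \<in> carrier_mat (n d) (n d)
          \<and> (\<forall>r<n d. \<forall>s<n d. \<bar>R d $$ (r, s)\<bar> \<le> C * \<bar>a d\<bar>)}"

text \<open>
  The expansion of the inverse covariance matrix along a family of designs with exponent \<open>\<epsilon>\<close>.
  Since \<open>mat_inverse\<close> is partial, it is meaningful only for invertible covariance matrices.
\<close>

definition inverse_expansion ::
  "'d filter \<Rightarrow> real \<Rightarrow> real \<Rightarrow> real \<Rightarrow> real \<Rightarrow> ('d \<Rightarrow> nat) \<Rightarrow> ('d \<Rightarrow> nat)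
     \<Rightarrow> ('d \<Rightarrow> nat \<Rightarrow> nat \<Rightarrow> nat) \<Rightarrow> real \<Rightarrow> bool" where
  "inverse_expansion F va vb vg ve g h m \<epsilon> \<longleftrightarrow>
     (\<lambda>d. the (mat_inverse (cov_mat va vb vg ve (g d) (h d) (m d)))
          - inv_leading vg ve (g d) (h d) (m d))
     \<in> bigo_mat F (\<lambda>d. num_obs (g d) (h d) (m d))
         (\<lambda>d. 1 / (min (real (g d) powr (1 - \<epsilon>)) (real (h d) powr (1 - \<epsilon>))
                   * (real (min_cell (g d) (h d) (m d)))\<^sup>2))"

end

theory Submission
  imports Defs "Jordan_Normal_Form.Determinant"
begin

text \<open>
  Let \<open>y\<close> be the column of the inverse belonging to an observation in the cell \<open>s\<close>, and
  \<open>w\<^sub>c = 1 / (ve + m\<^sub>c vg)\<close>. Writing \<open>u\<^sub>i\<^sub>j = a\<^sub>i + b\<^sub>j\<close> for minus the row and column contributions to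
  \<open>V y\<close>, the entries of \<open>y\<close> in the cell \<open>c\<close> differ from the leading term by exactly \<open>w\<^sub>c u\<^sub>c\<close>.
  An energy identity gives \<open>\<Sum>\<^sub>c m\<^sub>c w\<^sub>c u\<^sub>c\<^sup>2 \<le> w\<^sub>s \<bar>u\<^sub>s\<bar>\<close>, with \<open>m\<^sub>c w\<^sub>c \<ge> 1 / (ve + vg)\<close>. On the other hand each
  entry of an additive \<open>g \<times> h\<close> table satisfies \<open>u\<^sub>c\<^sup>2 \<le> (1/g + 1/h) \<Sum>u\<^sup>2\<close>. Together these give
  \<open>\<bar>u\<^sub>c\<bar> \<le> (1/g + 1/h) (ve + vg) w\<^sub>s\<close>, so the remainder is at most \<open>(1/g + 1/h) (ve + vg) w\<^sub>c w\<^sub>s\<close> and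
  \<open>\<epsilon> = 0\<close> works in all cases. The same estimate with right-hand side 0 shows that \<open>V\<close> is invertible.
\<close>

section \<open>Additive two-way tables\<close>

lemma sum_mult_of_bool_single:
  fixes f :: "nat \<Rightarrow> real"
  assumes "k < n"
  shows "(\<Sum>i<n. f i * of_bool (i = k)) = f k"
  using assms by (simp add: of_bool_def if_distrib cong: if_cong)

text \<open>The entry is the inner product of the table with \<open>q\<close>, the matching row of
  the orthogonal projection onto additive tables. Cauchy-Schwarz leaves the squared norm of
  \<open>q\<close>, which is (g + h - 1)/(gh): the dimension of the space of additive tables over
  the number of entries.\<close>

lemma additive_table_entry_bound:
  fixes a b :: "nat \<Rightarrow> real"
  assumes "i0 < g" and "j0 < h"
  shows "(a i0 + b j0)\<^sup>2 \<le> (1 / g + 1 / h) * (\<Sum>i<g. \<Sum>j<h. (a i + b j)\<^sup>2)"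
proof -
  \<comment> \<open>\<open>q\<close> represents the entry \<open>(i0, j0)\<close> as row mean plus column mean minus grand mean.\<close>
  define q where "q i j = of_bool (i = i0) / h + of_bool (j = j0) / g - 1 / (real g * h)" for i j
  have pos: "real g > 0" "real h > 0"
    using assms by auto
  have "(\<Sum>i<g. \<Sum>j<h. q i j * (a i + b j))
      = (\<Sum>j<h. \<Sum>i<g. (a i + b j) / h * of_bool (i = i0))
      + (\<Sum>i<g. \<Sum>j<h. (a i + b j) / g * of_bool (j = j0))
      - (\<Sum>i<g. \<Sum>j<h. (a i + b j) / (real g * h))"
    unfolding sum.swap[of _ "{..<g}" "{..<h}"] sum.distrib[symmetric] sum_subtractf[symmetric]
    by (intro sum.cong refl) (simp add: q_def algebra_simps add_divide_distrib)
  \<comment> \<open>The row mean is \<open>a i0\<close> plus the mean of \<open>b\<close>, the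
    column mean is \<open>b j0\<close> plus the mean of \<open>a\<close>, and subtracting the grand
    mean removes both means.\<close>
  also have "\<dots> = a i0 + b j0"
    using pos by (simp only: assms[THEN sum_mult_of_bool_single])
      (simp add: sum.distrib add_divide_distrib flip: sum_divide_distrib)
  finally have "(a i0 + b j0)\<^sup>2
      = (\<Sum>p\<in>{..<g} \<times> {..<h}. q (fst p) (snd p) * (a (fst p) + b (snd p)))\<^sup>2"
    by (simp add: sum.cartesian_product case_prod_beta)
  also have "\<dots> \<le> (\<Sum>p\<in>{..<g} \<times> {..<h}. (q (fst p) (snd p))\<^sup>2)
      * (\<Sum>p\<in>{..<g} \<times> {..<h}. (a (fst p) + b (snd p))\<^sup>2)"
    by (rule Cauchy_Schwarz_ineq_sum)
  also have "\<dots> = (\<Sum>i<g. \<Sum>j<h. (q i j)\<^sup>2) * (\<Sum>i<g. \<Sum>j<h. (a i + b j)\<^sup>2)"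
    by (simp add: sum.cartesian_product case_prod_beta)
  also have "\<dots> \<le> (1 / g + 1 / h) * (\<Sum>i<g. \<Sum>j<h. (a i + b j)\<^sup>2)"
  proof (intro mult_right_mono sum_nonneg)
    \<comment> \<open>Indicators are idempotent, so the square is affine in each of them and the
      sums over their indices collapse.\<close>
    have "(q i j)\<^sup>2 = (1 / h\<^sup>2 - 2 / (g * h\<^sup>2) + 2 / (g * h) * of_bool (j = j0)) * of_bool (i = i0)
        + (1 / g\<^sup>2 - 2 / (g\<^sup>2 * h)) * of_bool (j = j0) + 1 / (real g * h)\<^sup>2" for i j
      using pos by (cases "i = i0"; cases "j = j0") (simp_all add: q_def power2_eq_square field_simps)
    then have "(\<Sum>i<g. \<Sum>j<h. (q i j)\<^sup>2)
        = (\<Sum>i<g. \<Sum>j<h. (1 / h\<^sup>2 - 2 / (g * h\<^sup>2) + 2 / (g * h) * of_bool (j = j0)) * of_bool (i = i0))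
        + (\<Sum>i<g. \<Sum>j<h. (1 / g\<^sup>2 - 2 / (g\<^sup>2 * h)) * of_bool (j = j0)) + g * h * (1 / (real g * h)\<^sup>2)"
      by (simp only: sum.distrib) simp
    also have "(\<Sum>i<g. \<Sum>j<h. (1 / h\<^sup>2 - 2 / (g * h\<^sup>2) + 2 / (g * h) * of_bool (j = j0)) * of_bool (i = i0))
        = (\<Sum>j<h. \<Sum>i<g. (1 / h\<^sup>2 - 2 / (g * h\<^sup>2) + 2 / (g * h) * of_bool (j = j0)) * of_bool (i = i0))"
      by (rule sum.swap)
    also have "\<dots> = 1 / h - 2 / (real g * h) + 2 / (real g * h)"
      using pos by (simp only: assms[THEN sum_mult_of_bool_single] sum.distrib)
        (simp add: power2_eq_square field_simps)
    also have "(\<Sum>i<g. \<Sum>j<h. (1 / g\<^sup>2 - 2 / (g\<^sup>2 * h)) * of_bool (j = j0)) = 1 / g - 2 / (real g * h)"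
      using pos by (simp only: assms[THEN sum_mult_of_bool_single])
        (simp add: power2_eq_square field_simps)
    also have "1 / h - 2 / (real g * h) + 2 / (real g * h) + (1 / g - 2 / (real g * h))
        + g * h * (1 / (real g * h)\<^sup>2) = 1 / g + 1 / h - 1 / (real g * h)"
      using pos by (simp add: power2_eq_square field_simps)
    finally show "(\<Sum>i<g. \<Sum>j<h. (q i j)\<^sup>2) \<le> 1 / g + 1 / h"
      by simp
  qed simp
  finally show ?thesis .
qed

text \<open>
  Multiplying the two equations by \<open>a\<close> and \<open>b\<close> and summing bounds the energy
  \<open>\<Sum>t\<^sub>i\<^sub>j u\<^sub>i\<^sub>j\<^sup>2\<close> of \<open>u\<^sub>i\<^sub>j = a\<^sub>i + b\<^sub>j\<close> by \<open>w \<bar>u\<^sub>i\<^sub>0\<^sub>j\<^sub>0\<bar>\<close>; at the entry \<open>(i0, j0)\<close> the previous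
  lemma turns this into a self-improving estimate.
\<close>

lemma additive_effects_bound:
  fixes a b :: "nat \<Rightarrow> real" and t :: "nat \<Rightarrow> nat \<Rightarrow> real"
  assumes nonneg: "0 \<le> va" "0 \<le> vb" "0 \<le> w" and "0 < t0"
    and t: "\<And>i j. i < g \<Longrightarrow> j < h \<Longrightarrow> t0 \<le> t i j"
    and a: "\<And>i. i < g \<Longrightarrow> a i = - va * ((\<Sum>j<h. t i j * (a i + b j)) + of_bool (i = i0) * w)"
    and b: "\<And>j. j < h \<Longrightarrow> b j = - vb * ((\<Sum>i<g. t i j * (a i + b j)) + of_bool (j = j0) * w)"
    and s: "i0 < g" "j0 < h" and c: "i < g" "j < h"
  shows "\<bar>a i + b j\<bar> \<le> (1 / g + 1 / h) * w / t0"
proof -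
  define u where "u i j = a i + b j" for i j
  define S where "S = (\<Sum>i<g. \<Sum>j<h. (u i j)\<^sup>2)"
  define B where "B = (1 / g + 1 / h) / t0"
  have B: "0 \<le> B"
    using \<open>0 < t0\<close> by (simp add: B_def)
  \<comment> \<open>With \<open>q\<close> equal to \<open>va\<close> or \<open>vb\<close>, each
    effect is a nonpositive multiple of its bracket, so effect times bracket is
    \<open>- q * z\<^sup>2\<close>.\<close>
  have weighted_nonpos: "x * z \<le> 0" if "0 \<le> q" "x = - q * z" for x z q :: real
    using that by (simp add: mult.assoc)
  have "0 \<ge> (\<Sum>i<g. a i * ((\<Sum>j<h. t i j * u i j) + of_bool (i = i0) * w))"
    using weighted_nonpos[OF nonneg(1) a] by (intro sum_nonpos) (simp add: u_def)
  moreover have "(\<Sum>i<g. a i * ((\<Sum>j<h. t i j * u i j) + of_bool (i = i0) * w))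
      = (\<Sum>i<g. \<Sum>j<h. t i j * u i j * a i) + a i0 * w"
    using sum_mult_of_bool_single[OF s(1), of "\<lambda>i. w * a i"]
    by (simp add: distrib_left sum.distrib sum_distrib_left mult_ac)
  moreover have "0 \<ge> (\<Sum>j<h. b j * ((\<Sum>i<g. t i j * u i j) + of_bool (j = j0) * w))"
    using weighted_nonpos[OF nonneg(2) b] by (intro sum_nonpos) (simp add: u_def)
  moreover have "(\<Sum>j<h. b j * ((\<Sum>i<g. t i j * u i j) + of_bool (j = j0) * w))
      = (\<Sum>j<h. \<Sum>i<g. t i j * u i j * b j) + b j0 * w"
    using sum_mult_of_bool_single[OF s(2), of "\<lambda>j. w * b j"]
    by (simp add: distrib_left sum.distrib sum_distrib_left mult_ac)
  moreover have "(\<Sum>j<h. \<Sum>i<g. t i j * u i j * b j) = (\<Sum>i<g. \<Sum>j<h. t i j * u i j * b j)"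
    by (rule sum.swap)
  moreover have "(\<Sum>i<g. \<Sum>j<h. t i j * (u i j)\<^sup>2)
      = (\<Sum>i<g. \<Sum>j<h. t i j * u i j * a i) + (\<Sum>i<g. \<Sum>j<h. t i j * u i j * b j)"
    unfolding sum.distrib[symmetric] by (simp add: u_def power2_eq_square algebra_simps)
  moreover have "t0 * S \<le> (\<Sum>i<g. \<Sum>j<h. t i j * (u i j)\<^sup>2)"
    unfolding S_def sum_distrib_left by (intro sum_mono mult_right_mono) (auto intro: t)
  \<comment> \<open>Adding the two energy inequalities recombines \<open>a i\<close> and
    \<open>b j\<close> into \<open>u i j\<close>, while the sources contribute
    \<open>w * u i0 j0\<close>.\<close>
  ultimately have "t0 * S \<le> - (u i0 j0 * w)"
    by (simp add: u_def algebra_simps)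
  also have "\<dots> \<le> \<bar>u i0 j0\<bar> * w"
    using nonneg(3) by (metis abs_ge_minus_self abs_mult abs_of_nonneg)
  finally have S: "t0 * S \<le> \<bar>u i0 j0\<bar> * w" .
  have u: "(u i j)\<^sup>2 \<le> \<bar>u i0 j0\<bar> * (B * w)" if "i < g" "j < h" for i j
  proof -
    have "(u i j)\<^sup>2 \<le> (1 / g + 1 / h) * S"
      using additive_table_entry_bound[OF that] by (simp add: u_def S_def)
    also have "\<dots> = B * (t0 * S)"
      using \<open>0 < t0\<close> by (simp add: B_def)
    also have "\<dots> \<le> B * (\<bar>u i0 j0\<bar> * w)"
      using S B by (rule mult_left_mono)
    finally show ?thesis by (simp add: mult_ac)
  qed
  have "\<bar>u i0 j0\<bar> * \<bar>u i0 j0\<bar> \<le> \<bar>u i0 j0\<bar> * (B * w)"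
    using u[OF s] by (simp add: power2_eq_square)
  \<comment> \<open>One factor \<open>\<bar>u i0 j0\<bar>\<close> cancels; if it is zero, the bound
    is trivial.\<close>
  then have u0: "\<bar>u i0 j0\<bar> \<le> B * w"
    using B nonneg(3) by (metis abs_zero mult_le_cancel_left_pos mult_nonneg_nonneg zero_less_abs_iff)
  \<comment> \<open>The bound at the source entry is fed back into \<open>u\<close> to control every
    other entry.\<close>
  have "(u i j)\<^sup>2 \<le> (B * w)\<^sup>2"
    using u[OF c] mult_right_mono[OF u0, of "B * w"] B nonneg(3) by (simp add: power2_eq_square)
  then have "\<bar>u i j\<bar> \<le> B * w"
    using B nonneg(3) abs_le_square_iff[of "u i j" "B * w"] by simp
  then show ?thesis
    by (simp add: u_def B_def)
qed

section \<open>The covariance equations in observation coordinates\<close>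

text \<open>
  The \<open>va\<close> and \<open>vb\<close> terms of the equations are additive effects, and solving within a cell for
  given effects yields the leading term plus the effect \<open>a i + b j\<close> scaled by \<open>w i j\<close>.
\<close>

lemma covariance_equations_solution:
  fixes y :: "nat \<times> nat \<times> nat \<Rightarrow> real" and m :: "nat \<Rightarrow> nat \<Rightarrow> nat"
    and va vb vg ve p :: real and g h i j k i0 j0 k0 :: nat
  defines "Y \<equiv> \<lambda>(i::nat) (j::nat). \<Sum>k<m i j. y (i, j, k)"
  defines "w \<equiv> \<lambda>(i::nat) (j::nat). 1 / (ve + real (m i j) * vg)"
  assumes "0 \<le> va" "0 \<le> vb" "0 \<le> vg" "0 < ve" "0 \<le> p"
    and m: "\<And>i j. i < g \<Longrightarrow> j < h \<Longrightarrow> 1 \<le> m i j"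
    and eq: "\<And>i j k. i < g \<Longrightarrow> j < h \<Longrightarrow> k < m i j \<Longrightarrow>
      va * (\<Sum>j'<h. Y i j') + vb * (\<Sum>i'<g. Y i' j) + vg * Y i j + ve * y (i, j, k)
      = p * of_bool ((i, j, k) = (i0, j0, k0))"
    and s: "i0 < g" "j0 < h" "k0 < m i0 j0" and r: "i < g" "j < h" "k < m i j"
  shows "\<bar>y (i, j, k) - p * (of_bool ((i, j, k) = (i0, j0, k0)) / ve
      - vg / ve * (of_bool ((i, j) = (i0, j0)) * w i j))\<bar>
    \<le> p * ((1 / g + 1 / h) * (ve + vg) * w i j * w i0 j0)"
proof -
  define a where "a i = - va * (\<Sum>j<h. Y i j)" for i
  define b where "b j = - vb * (\<Sum>i<g. Y i j)" for j
  define t where "t i j = real (m i j) * w i j" for i j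
  have D: "0 < ve + real (m i j) * vg" for i j
    using assms by (simp add: add_pos_nonneg)
  have w: "0 < w i j" for i j
    using D by (simp add: w_def)
  have y: "ve * y (i, j, k) = p * of_bool ((i, j, k) = (i0, j0, k0)) + (a i + b j) - vg * Y i j"
    if "i < g" "j < h" "k < m i j" for i j k
    using eq[OF that] by (simp add: a_def b_def)
  have Y: "Y i j = p * of_bool ((i, j) = (i0, j0)) * w i j + t i j * (a i + b j)"
    if ij: "i < g" "j < h" for i j
  proof -
    \<comment> \<open>Summing over the cell meets the source observation at most once and leaves a
      scalar equation for \<open>Y i j\<close>.\<close>
    have "ve * Y i j = (\<Sum>k<m i j. p * of_bool ((i, j, k) = (i0, j0, k0)) + (a i + b j) - vg * Y i j)"
      using y[OF ij] by (simp add: Y_def sum_distrib_left)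
    also have "\<dots> = p * (\<Sum>k<m i j. of_bool ((i, j, k) = (i0, j0, k0)))
        + real (m i j) * (a i + b j - vg * Y i j)"
      by (simp add: sum.distrib sum_subtractf sum_distrib_left algebra_simps)
    also have "(\<Sum>k<m i j. of_bool ((i, j, k) = (i0, j0, k0))) = (of_bool ((i, j) = (i0, j0)) :: real)"
      using s by (cases "(i, j) = (i0, j0)") (auto simp: of_bool_def)
    finally have "(ve + real (m i j) * vg) * Y i j = p * of_bool ((i, j) = (i0, j0)) + real (m i j) * (a i + b j)"
      by (simp add: algebra_simps)
    then have "Y i j = (p * of_bool ((i, j) = (i0, j0)) + real (m i j) * (a i + b j)) / (ve + real (m i j) * vg)"
      using D[of i j] by (simp add: eq_divide_eq mult.commute)
    then show ?thesis
      by (simp add: t_def w_def add_divide_distrib)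
  qed
  \<comment> \<open>The source has strength \<open>p * w i0 j0\<close>. The weights
    \<open>t i j\<close> are at least \<open>1 / (ve + vg)\<close> because every cell holds at least
    one observation.\<close>
  have "\<bar>a i + b j\<bar> \<le> (1 / g + 1 / h) * (p * w i0 j0) / (1 / (ve + vg))"
  proof (rule additive_effects_bound[where va = va and vb = vb and t = t, OF _ _ _ _ _ _ _ s(1,2) r(1,2)])
    show "1 / (ve + vg) \<le> t i j" if "i < g" "j < h" for i j
    proof -
      have "ve + real (m i j) * vg \<le> real (m i j) * (ve + vg)"
        using m[OF that] \<open>0 < ve\<close> by (simp add: distrib_left)
      then show ?thesis
        using D[of i j] assms by (simp add: t_def w_def field_simps)
    qed
    show "a i = - va * ((\<Sum>j<h. t i j * (a i + b j)) + of_bool (i = i0) * (p * w i0 j0))"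
      if "i < g" for i
    proof -
      have "(\<Sum>j<h. Y i j) = (\<Sum>j<h. p * of_bool ((i, j) = (i0, j0)) * w i j + t i j * (a i + b j))"
        using Y that by simp
      also have "\<dots> = (\<Sum>j<h. p * of_bool (i = i0) * w i j * of_bool (j = j0)) + (\<Sum>j<h. t i j * (a i + b j))"
        unfolding sum.distrib[symmetric] by (intro sum.cong refl) auto
      also have "\<dots> = (\<Sum>j<h. t i j * (a i + b j)) + of_bool (i = i0) * (p * w i0 j0)"
        unfolding sum_mult_of_bool_single[OF s(2)] by (cases "i = i0") simp_all
      finally show ?thesis
        by (rule trans[OF a_def arg_cong[where f = "(*) (- va)"]])
    qed
    show "b j = - vb * ((\<Sum>i<g. t i j * (a i + b j)) + of_bool (j = j0) * (p * w i0 j0))"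
      if "j < h" for j
    proof -
      have "(\<Sum>i<g. Y i j) = (\<Sum>i<g. p * of_bool ((i, j) = (i0, j0)) * w i j + t i j * (a i + b j))"
        using Y that by simp
      also have "\<dots> = (\<Sum>i<g. p * of_bool (j = j0) * w i j * of_bool (i = i0)) + (\<Sum>i<g. t i j * (a i + b j))"
        unfolding sum.distrib[symmetric] by (intro sum.cong refl) auto
      also have "\<dots> = (\<Sum>i<g. t i j * (a i + b j)) + of_bool (j = j0) * (p * w i0 j0)"
        unfolding sum_mult_of_bool_single[OF s(1)] by (cases "j = j0") simp_all
      finally show ?thesis
        by (rule trans[OF b_def arg_cong[where f = "(*) (- vb)"]])
    qed
  qed (use assms w[of i0 j0] in auto)
  then have u: "\<bar>a i + b j\<bar> \<le> p * ((1 / g + 1 / h) * (ve + vg) * w i0 j0)"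
    by (simp add: mult_ac)
  \<comment> \<open>This identity produces the second weight: after the interaction term has acted,
    the fraction \<open>ve * w i j\<close> of the effect remains.\<close>
  have "1 - vg * t i j = ve * w i j"
    using D[of i j] by (simp add: t_def w_def field_simps)
  then have "(a i + b j) * (1 - vg * t i j) = ve * ((a i + b j) * w i j)"
    by simp
  moreover have "ve * (y (i, j, k) - p * (of_bool ((i, j, k) = (i0, j0, k0)) / ve
      - vg / ve * (of_bool ((i, j) = (i0, j0)) * w i j))) = (a i + b j) * (1 - vg * t i j)"
    using \<open>0 < ve\<close> y[OF r] Y[OF r(1,2)] by (simp add: algebra_simps)
  ultimately have eq: "ve * (y (i, j, k) - p * (of_bool ((i, j, k) = (i0, j0, k0)) / ve
      - vg / ve * (of_bool ((i, j) = (i0, j0)) * w i j))) = ve * ((a i + b j) * w i j)"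
    by (rule trans[rotated])
  have "y (i, j, k) - p * (of_bool ((i, j, k) = (i0, j0, k0)) / ve
      - vg / ve * (of_bool ((i, j) = (i0, j0)) * w i j)) = (a i + b j) * w i j"
    by (rule iffD1[OF mult_left_cancel eq]) (use \<open>0 < ve\<close> in simp)
  then show ?thesis
    using mult_right_mono[OF u, of "w i j"] w[of i j] by (simp add: abs_mult mult_ac)
qed

section \<open>Enumeration of observations and entries of the leading term\<close>

lemma set_obs: "set (obs g h m) = (SIGMA i:{..<g}. SIGMA j:{..<h}. {..<m i j})"
  by (force simp: obs_def)

text \<open>Grouping by cell matches the positions of the observations with the consecutive diagonal
  blocks of the leading term.\<close>

lemma obs_eq_concat_cells:
  "obs g h m = concat (map (\<lambda>(i, j). map (\<lambda>k. (i, j, k)) [0..<m i j]) (cells g h))"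
proof -
  have "concat (map (\<lambda>i. concat (map (\<lambda>j. map (\<lambda>k. (i, j, k)) [0..<m i j]) [0..<h])) is)
    = concat (map (\<lambda>(i, j). map (\<lambda>k. (i, j, k)) [0..<m i j]) (concat (map (\<lambda>i. map (Pair i) [0..<h]) is)))"
    for "is"
    by (induction "is") (simp_all add: comp_def)
  then show ?thesis
    by (simp add: obs_def cells_def)
qed

lemma distinct_cells: "distinct (cells g h)"
  using distinct_product[of "[0..<g]" "[0..<h]"] by (simp add: cells_def product_concat_map)

lemma set_cells: "set (cells g h) = {..<g} \<times> {..<h}"
  by (auto simp: cells_def)

text \<open>The length of the list equals the cardinality of its set of triples.\<close>

lemma distinct_obs: "distinct (obs g h m)"
  by (rule card_distinct) (simp add: set_obs length_obs num_obs_def)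

lemma sum_obs:
  fixes f :: "nat \<times> nat \<times> nat \<Rightarrow> 'a::comm_monoid_add"
  shows "(\<Sum>r<num_obs g h m. f (obs g h m ! r)) = (\<Sum>i<g. \<Sum>j<h. \<Sum>k<m i j. f (i, j, k))"
proof -
  have "(\<Sum>r<num_obs g h m. f (obs g h m ! r)) = sum f (set (obs g h m))"
    by (intro sum.reindex_bij_betw bij_betw_nth distinct_obs) (simp_all add: length_obs)
  then show ?thesis
    by (simp add: set_obs sum.Sigma)
qed

lemma dim_ones_mat [simp]: "dim_row (ones_mat a) = a" "dim_col (ones_mat a) = a"
  by (simp_all add: ones_mat_def)

text \<open>\<open>L\<close> labels each row with the block containing it; since \<open>cs\<close>
  is distinct, equal labels mean the same block. The induction splits off the first block.\<close>

lemma index_diag_block_ones: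
  assumes "distinct cs"
    and "L = concat (map (\<lambda>c. replicate (n c) c) cs)" and "r < length L" and "s < length L"
  shows "diag_block_mat (map (\<lambda>c. v c \<cdot>\<^sub>m ones_mat (n c)) cs) $$ (r, s)
    = of_bool (L ! r = L ! s) * v (L ! r)"
  using assms
proof (induction cs arbitrary: L r s)
  case (Cons c cs)
  define L' where "L' = concat (map (\<lambda>c. replicate (n c) c) cs)"
  define B where "B = diag_block_mat (map (\<lambda>c. v c \<cdot>\<^sub>m ones_mat (n c)) cs)"
  have L: "L = replicate (n c) c @ L'"
    using Cons.prems by (simp add: L'_def)
  have dim: "dim_row B = length L'" "dim_col B = length L'"
    by (simp_all add: B_def L'_def dim_diag_block_mat length_concat comp_def)
  have "set L' \<subseteq> set cs"
    by (auto simp: L'_def)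
  then have c: "L' ! q \<noteq> c" if "q < length L'" for q
    using Cons.prems(1) that nth_mem by fastforce
  have "B $$ (r', s') = of_bool (L' ! r' = L' ! s') * v (L' ! r')"
    if "r' < length L'" "s' < length L'" for r' s'
    using Cons.IH[of L' r' s'] Cons.prems(1) that by (simp add: B_def L'_def)
  moreover have "diag_block_mat (map (\<lambda>c. v c \<cdot>\<^sub>m ones_mat (n c)) (c # cs))
      = four_block_mat (v c \<cdot>\<^sub>m ones_mat (n c)) (0\<^sub>m (n c) (length L')) (0\<^sub>m (length L') (n c)) B"
    by (simp add: Let_def dim flip: B_def)
  ultimately show ?case
    using Cons.prems(3,4) c[of "r - n c"] c[of "s - n c", symmetric]
    by (cases "r < n c"; cases "s < n c") (auto simp: L nth_append dim ones_mat_def)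
qed simp

lemma inv_leading_index:
  assumes r: "r < num_obs g h m" and s: "s < num_obs g h m"
    and "obs g h m ! r = (i, j, k)" and "obs g h m ! s = (i', j', k')"
  shows "inv_leading vg ve g h m $$ (r, s) = of_bool ((i, j, k) = (i', j', k')) / ve
    - vg / ve * (of_bool ((i, j) = (i', j')) * (1 / (ve + real (m i j) * vg)))"
proof -
  define L where "L = map (\<lambda>(i, j, k). (i, j)) (obs g h m)"
  define n where "n c = m (fst c) (snd c)" for c
  define v where "v c = 1 / (ve + real (n c) * vg)" for c
  let ?D = "diag_block_mat (map (\<lambda>c. v c \<cdot>\<^sub>m ones_mat (n c)) (cells g h))"
  have L: "L = concat (map (\<lambda>c. replicate (n c) c) (cells g h))"
    by (simp add: L_def n_def obs_eq_concat_cells map_concat comp_def case_prod_beta map_replicate_const)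
  have len: "length L = num_obs g h m"
    by (simp add: L_def length_obs)
  have "dim_row ?D = length L" "dim_col ?D = length L"
    by (simp_all add: L dim_diag_block_mat length_concat comp_def)
  moreover have "?D $$ (r, s) = of_bool (L ! r = L ! s) * v (L ! r)"
    by (rule index_diag_block_ones[OF distinct_cells L]) (use r s len in auto)
  moreover have "L ! r = (i, j)" "L ! s = (i', j')"
    using assms by (simp_all add: L_def length_obs)
  moreover have "r = s \<longleftrightarrow> (i, j, k) = (i', j', k')"
    using assms nth_eq_iff_index_eq[OF distinct_obs[of g h m], of r s] by (simp add: length_obs)
  moreover have "inv_leading vg ve g h m = (1 / ve) \<cdot>\<^sub>m 1\<^sub>m (num_obs g h m) - (vg / ve) \<cdot>\<^sub>m ?D"
    by (simp add: inv_leading_def v_def n_def case_prod_unfold)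
  ultimately show ?thesis
    using r s len by (simp add: v_def n_def)
qed

section \<open>The covariance matrix as a linear system\<close>

lemma cov_mat_mult_vec:
  fixes y :: "nat \<times> nat \<times> nat \<Rightarrow> real" and m :: "nat \<Rightarrow> nat \<Rightarrow> nat"
  defines "Y \<equiv> \<lambda>(i::nat) (j::nat). \<Sum>k<m i j. y (i, j, k)"
  assumes v: "v \<in> carrier_vec (num_obs g h m)"
    and y: "\<And>r. r < num_obs g h m \<Longrightarrow> y (obs g h m ! r) = v $ r"
    and r: "r < num_obs g h m" "obs g h m ! r = (i, j, k)"
  shows "(cov_mat va vb vg ve g h m *\<^sub>v v) $ r
    = va * (\<Sum>j'<h. Y i j') + vb * (\<Sum>i'<g. Y i' j) + vg * Y i j + ve * y (i, j, k)"
proof -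
  have ijk: "i < g" "j < h" "k < m i j"
    using nth_mem[of r "obs g h m"] r by (auto simp: length_obs set_obs)
  have "(cov_mat va vb vg ve g h m *\<^sub>v v) $ r
    = (\<Sum>s<num_obs g h m. obs_cov va vb vg ve (i, j, k) (obs g h m ! s) * y (obs g h m ! s))"
    using v r by (simp add: cov_mat_def scalar_prod_def y atLeast0LessThan)
  also have "\<dots> = (\<Sum>i'<g. \<Sum>j'<h. \<Sum>k'<m i' j'.
      obs_cov va vb vg ve (i, j, k) (i', j', k') * y (i', j', k'))"
    by (rule sum_obs)
  \<comment> \<open>All but the \<open>ve\<close> term depend only on the cells, so the inner sums
    become cell totals. A separate indicator factor for each index lets the sums collapse one at a
    time.\<close>
  also have "\<dots> = (\<Sum>i'<g. \<Sum>j'<h. va * Y i' j' * of_bool (i' = i) + vb * Y i' j' * of_bool (j' = j)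
      + vg * Y i' j' * of_bool (j' = j) * of_bool (i' = i)
      + ve * (\<Sum>k'<m i' j'. y (i', j', k') * of_bool (k' = k)) * of_bool (j' = j) * of_bool (i' = i))"
  proof (intro sum.cong refl)
    fix i' j'
    show "(\<Sum>k'<m i' j'. obs_cov va vb vg ve (i, j, k) (i', j', k') * y (i', j', k'))
      = va * Y i' j' * of_bool (i' = i) + vb * Y i' j' * of_bool (j' = j)
        + vg * Y i' j' * of_bool (j' = j) * of_bool (i' = i)
        + ve * (\<Sum>k'<m i' j'. y (i', j', k') * of_bool (k' = k)) * of_bool (j' = j) * of_bool (i' = i)"
      unfolding Y_def sum_distrib_left sum_distrib_right sum.distrib[symmetric]
      by (intro sum.cong refl) (cases "i' = i"; cases "j' = j"; simp add: distrib_right)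
  qed
  also have "\<dots> = va * (\<Sum>j'<h. Y i j') + vb * (\<Sum>i'<g. Y i' j) + vg * Y i j + ve * y (i, j, k)"
    by (simp only: sum.distrib sum_distrib_left[symmetric] sum_distrib_right[symmetric]
        ijk[THEN sum_mult_of_bool_single])
  finally show ?thesis .
qed

text \<open>The parameter \<open>p\<close> covers two uses: \<open>p = 1\<close> for a column of the
  inverse, and \<open>p = 0\<close> for a kernel vector, which must then vanish.\<close>

lemma cov_mat_solution_bound:
  assumes nonneg: "0 \<le> va" "0 \<le> vb" "0 \<le> vg" "0 < ve" "0 \<le> p"
    and m: "\<And>i j. i < g \<Longrightarrow> j < h \<Longrightarrow> 1 \<le> m i j"
    and D: "\<And>i j. i < g \<Longrightarrow> j < h \<Longrightarrow> 1 / (ve + real (m i j) * vg) \<le> D"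
    and v: "v \<in> carrier_vec (num_obs g h m)"
    and eq: "cov_mat va vb vg ve g h m *\<^sub>v v = p \<cdot>\<^sub>v unit_vec (num_obs g h m) s"
    and r: "r < num_obs g h m" and s: "s < num_obs g h m"
  shows "\<bar>v $ r - p * inv_leading vg ve g h m $$ (r, s)\<bar> \<le> p * ((1 / g + 1 / h) * (ve + vg) * D\<^sup>2)"
proof -
  obtain i j k i0 j0 k0 where ijk: "obs g h m ! r = (i, j, k)" "obs g h m ! s = (i0, j0, k0)"
    by (metis prod_cases3)
  have lt: "i < g" "j < h" "k < m i j" "i0 < g" "j0 < h" "k0 < m i0 j0"
    using nth_mem[of r "obs g h m"] nth_mem[of s "obs g h m"] ijk r s by (auto simp: length_obs set_obs)
  \<comment> \<open>The vector is reindexed by triples through the inverse of the enumeration; only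
    values at observations enter the sums.\<close>
  define y where "y o' = v $ the_inv_into {..<num_obs g h m} ((!) (obs g h m)) o'" for o'
  have bij: "bij_betw ((!) (obs g h m)) {..<num_obs g h m} (set (obs g h m))"
    by (intro bij_betw_nth distinct_obs) (simp_all add: length_obs)
  have y: "y (obs g h m ! q) = v $ q" if "q < num_obs g h m" for q
    using the_inv_into_f_f[OF bij_betw_imp_inj_on[OF bij]] that by (simp add: y_def)
  define w where "w i j = 1 / (ve + real (m i j) * vg)" for i j
  have w: "0 \<le> w i j" for i j
    using nonneg by (simp add: w_def)
  have "\<bar>y (i, j, k) - p * (of_bool ((i, j, k) = (i0, j0, k0)) / ve
      - vg / ve * (of_bool ((i, j) = (i0, j0)) * (1 / (ve + real (m i j) * vg))))\<bar>
    \<le> p * ((1 / g + 1 / h) * (ve + vg) * (1 / (ve + real (m i j) * vg)) * (1 / (ve + real (m i0 j0) * vg)))"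
  proof (rule covariance_equations_solution[OF nonneg m _ lt(4-6,1-3)])
    fix i j k assume "i < g" "j < h" "k < m i j"
    then have "(i, j, k) \<in> set (obs g h m)"
      by (simp add: set_obs)
    then obtain q where q: "q < num_obs g h m" "obs g h m ! q = (i, j, k)"
      by (metis in_set_conv_nth length_obs)
    have "q = s \<longleftrightarrow> (i, j, k) = (i0, j0, k0)"
      using q ijk s nth_eq_iff_index_eq[OF distinct_obs[of g h m], of q s] by (simp add: length_obs)
    moreover have "(cov_mat va vb vg ve g h m *\<^sub>v v) $ q = p * of_bool (q = s)"
      using q s by (simp add: eq)
    ultimately show "va * (\<Sum>j'<h. \<Sum>k<m i j'. y (i, j', k)) + vb * (\<Sum>i'<g. \<Sum>k<m i' j. y (i', j, k))
        + vg * (\<Sum>k<m i j. y (i, j, k)) + ve * y (i, j, k) = p * of_bool ((i, j, k) = (i0, j0, k0))"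
      using cov_mat_mult_vec[where y = y, OF v y q] by simp
  qed auto
  also have "\<dots> = p * ((1 / g + 1 / h) * (ve + vg) * (w i j * w i0 j0))"
    by (simp add: w_def)
  also have "\<dots> \<le> p * ((1 / g + 1 / h) * (ve + vg) * (D * D))"
  proof (intro mult_left_mono mult_mono)
    show "w i j \<le> D" "w i0 j0 \<le> D"
      using D lt by (simp_all add: w_def)
    then show "0 \<le> D"
      using w order_trans by blast
  qed (use nonneg w in simp_all)
  finally show ?thesis
    by (simp only: inv_leading_index[OF r s ijk] y[OF r, symmetric] ijk(1) power2_eq_square)
qed

section \<open>Invertibility and the remainder of the inverse\<close>

lemma cov_mat_carrier: "cov_mat va vb vg ve g h m \<in> carrier_mat (num_obs g h m) (num_obs g h m)"
  by (simp add: cov_mat_def)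

text \<open>A kernel vector solves the system with \<open>p = 0\<close>, and the solution bound
  forces all its entries to be zero.\<close>

lemma det_cov_mat_nonzero:
  assumes "0 \<le> va" "0 \<le> vb" "0 \<le> vg" "0 < ve"
    and "\<And>i j. i < g \<Longrightarrow> j < h \<Longrightarrow> 1 \<le> m i j"
  shows "Determinant.det (cov_mat va vb vg ve g h m) \<noteq> 0"
proof
  let ?n = "num_obs g h m"
  assume "Determinant.det (cov_mat va vb vg ve g h m) = 0"
  then obtain v where v: "v \<in> carrier_vec ?n" "v \<noteq> 0\<^sub>v ?n" "cov_mat va vb vg ve g h m *\<^sub>v v = 0\<^sub>v ?n"
    using det_0_iff_vec_prod_zero_field[OF cov_mat_carrier] by blast
  have "v $ r = 0" if r: "r < ?n" for r
  proof -
    \<comment> \<open>Any uniform bound serves here, since it is multiplied by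
      \<open>p = 0\<close>.\<close>
    have D: "1 / (ve + real (m i j) * vg) \<le> 1 / ve" for i j
      using assms by (simp add: frac_le)
    have "cov_mat va vb vg ve g h m *\<^sub>v v = 0 \<cdot>\<^sub>v unit_vec ?n r"
      using v r by auto
    from cov_mat_solution_bound[OF assms(1-4) order_refl assms(5) D v(1) this r r]
    show ?thesis by simp
  qed
  with v(1,2) show False by auto
qed

lemma inverse_cov_mat:
  assumes "0 \<le> va" "0 \<le> vb" "0 \<le> vg" "0 < ve"
    and "\<And>i j. i < g \<Longrightarrow> j < h \<Longrightarrow> 1 \<le> m i j"
  defines "n \<equiv> num_obs g h m" and "V \<equiv> cov_mat va vb vg ve g h m"
  shows "the (mat_inverse V) \<in> carrier_mat n n" "V * the (mat_inverse V) = 1\<^sub>m n"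
    "the (mat_inverse V) * V = 1\<^sub>m n"
proof -
  have V: "V \<in> carrier_mat n n"
    by (simp add: n_def V_def cov_mat_carrier)
  have "V \<in> Units (ring_mat TYPE(real) n ())"
    using det_non_zero_imp_unit[OF V] det_cov_mat_nonzero[OF assms(1-5)] by (simp add: V_def)
  then obtain B where "mat_inverse V = Some B"
    using mat_inverse(1)[OF V, of "()"] by (cases "mat_inverse V") auto
  with mat_inverse(2)[OF V this]
  show "the (mat_inverse V) \<in> carrier_mat n n" "V * the (mat_inverse V) = 1\<^sub>m n"
    "the (mat_inverse V) * V = 1\<^sub>m n"
    by auto
qed

lemma inv_leading_carrier: "inv_leading vg ve g h m \<in> carrier_mat (num_obs g h m) (num_obs g h m)"
proof -
  let ?D = "map (\<lambda>(i, j). (1 / (ve + real (m i j) * vg)) \<cdot>\<^sub>m ones_mat (m i j)) (cells g h)"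
  have "sum_list (map (\<lambda>(i, j). m i j) (cells g h)) = num_obs g h m"
    by (simp add: sum_list_distinct_conv_sum_set distinct_cells set_cells num_obs_def sum.cartesian_product)
  moreover have "map dim_row ?D = map (\<lambda>(i, j). m i j) (cells g h)" "map dim_col ?D = map (\<lambda>(i, j). m i j) (cells g h)"
    by auto
  ultimately have "diag_block_mat ?D \<in> carrier_mat (num_obs g h m) (num_obs g h m)"
    by (intro carrier_matI) (simp_all only: dim_diag_block_mat)
  then show ?thesis
    unfolding inv_leading_def by (intro minus_carrier_mat smult_carrier_mat)
qed

text \<open>Column \<open>s\<close> of the inverse solves the system for the unit vector
  \<open>s\<close>, so the solution bound applies with \<open>p = 1\<close>.\<close>

lemma inverse_cov_mat_remainder_bound:
  assumes "0 \<le> va" "0 \<le> vb" "0 \<le> vg" "0 < ve"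
    and m: "\<And>i j. i < g \<Longrightarrow> j < h \<Longrightarrow> 1 \<le> m i j"
    and D: "\<And>i j. i < g \<Longrightarrow> j < h \<Longrightarrow> 1 / (ve + real (m i j) * vg) \<le> D"
    and r: "r < num_obs g h m" and s: "s < num_obs g h m"
  shows "\<bar>(the (mat_inverse (cov_mat va vb vg ve g h m)) - inv_leading vg ve g h m) $$ (r, s)\<bar>
    \<le> (1 / g + 1 / h) * (ve + vg) * D\<^sup>2"
proof -
  let ?n = "num_obs g h m" and ?B = "the (mat_inverse (cov_mat va vb vg ve g h m))"
  note B = inverse_cov_mat[of va vb vg ve g h m, OF assms(1-5)]
  have "cov_mat va vb vg ve g h m *\<^sub>v col ?B s = 1 \<cdot>\<^sub>v unit_vec ?n s"
    using col_mult2[OF cov_mat_carrier B(1) s, of va vb vg ve] B(2) s by simp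
  from cov_mat_solution_bound[OF assms(1-4) zero_le_one m D _ this r s] B(1) r s
  show ?thesis
    using inv_leading_carrier[of vg ve g h m] by auto
qed

section \<open>Asymptotics along the family of designs\<close>

lemma min_cell_le: "i < g \<Longrightarrow> j < h \<Longrightarrow> min_cell g h m \<le> m i j"
  unfolding min_cell_def by (rule Min_le) auto

lemma min_cell_ge_1:
  assumes "1 \<le> g" "1 \<le> h" "\<And>i j. i < g \<Longrightarrow> j < h \<Longrightarrow> 1 \<le> m i j"
  shows "1 \<le> min_cell g h m"
  unfolding min_cell_def using assms by (subst Min_ge_iff) (auto simp: lessThan_empty_iff)

text \<open>The remainder bound is used with \<open>D = E / mL d\<close>, whose square gives the
  decay in the smallest cell size. Since 1/g + 1/h is at most 2/min(g, h), the constant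
  \<open>C\<close> carries a factor 2.\<close>

lemma inverse_expansion_zero:
  fixes F :: "'d filter"
    and g h :: "'d \<Rightarrow> nat"
    and m :: "'d \<Rightarrow> nat \<Rightarrow> nat \<Rightarrow> nat"
    and va vb vg ve :: real
  assumes nonneg: "va \<ge> 0" "vb \<ge> 0" "vg \<ge> 0" "ve > 0"
    and g: "\<And>d. g d \<ge> 1" and h: "\<And>d. h d \<ge> 1"
    and m: "\<And>d i j. i < g d \<Longrightarrow> j < h d \<Longrightarrow> m d i j \<ge> 1"
    and bounded: "vg > 0 \<or> (\<exists>B. \<forall>\<^sub>F d in F. min_cell (g d) (h d) (m d) \<le> B)"
  shows "inverse_expansion F va vb vg ve g h m 0"
proof -
  define mL where "mL d = real (min_cell (g d) (h d) (m d))" for d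
  have mL: "0 < mL d" for d
    using min_cell_ge_1[of "g d" "h d" "m d", OF g h m] by (simp add: mL_def)
  have mL_le: "mL d \<le> real (m d i j)" if "i < g d" "j < h d" for d i j
    using min_cell_le[OF that, of "m d"] by (simp add: mL_def)
  \<comment> \<open>For positive \<open>vg\<close> the denominator is at least
    \<open>mL d * vg\<close>, so \<open>E = 1 / vg\<close>. For \<open>vg = 0\<close> the weight is
    \<open>1 / ve\<close>, which is at most \<open>(B / ve) / mL d\<close> once the smallest cell
    size is bounded by \<open>B\<close>.\<close>
  obtain E where E: "\<forall>\<^sub>F d in F. \<forall>i<g d. \<forall>j<h d. 1 / (ve + real (m d i j) * vg) \<le> E / mL d"
  proof (cases "vg > 0")
    case True
    have "1 / (ve + real (m d i j) * vg) \<le> (1 / vg) / mL d" if "i < g d" "j < h d" for d i j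
    proof -
      have "mL d * vg \<le> ve + real (m d i j) * vg"
        using mult_right_mono[OF mL_le[OF that], of vg] nonneg by simp
      then show ?thesis
        using True mL[of d] by (simp add: frac_le mult.commute)
    qed
    then show ?thesis by (intro that[of "1 / vg"]) simp
  next
    case False
    with bounded obtain B where "\<forall>\<^sub>F d in F. min_cell (g d) (h d) (m d) \<le> B"
      by blast
    then have "\<forall>\<^sub>F d in F. \<forall>i<g d. \<forall>j<h d. 1 / (ve + real (m d i j) * vg) \<le> (real B / ve) / mL d"
      using False nonneg mL by (auto elim!: eventually_mono simp: mL_def field_simps)
    then show ?thesis by (rule that)
  qed
  define C where "C = 2 * (ve + vg) * E\<^sup>2"
  have "\<forall>\<^sub>F d in F. the (mat_inverse (cov_mat va vb vg ve (g d) (h d) (m d)))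
            - inv_leading vg ve (g d) (h d) (m d)
          \<in> carrier_mat (num_obs (g d) (h d) (m d)) (num_obs (g d) (h d) (m d))
      \<and> (\<forall>r<num_obs (g d) (h d) (m d). \<forall>s<num_obs (g d) (h d) (m d).
          \<bar>(the (mat_inverse (cov_mat va vb vg ve (g d) (h d) (m d)))
            - inv_leading vg ve (g d) (h d) (m d)) $$ (r, s)\<bar>
          \<le> C * \<bar>1 / (min (real (g d) powr (1 - 0)) (real (h d) powr (1 - 0)) * (mL d)\<^sup>2)\<bar>)"
    using E
  proof eventually_elim
    case (elim d)
    have g': "0 < real (g d)" and h': "0 < real (h d)"
      using g[of d] h[of d] by auto
    have "1 / real (g d) + 1 / real (h d) \<le> 2 / min (real (g d)) (real (h d))"
      using g' h' frac_le[of 1 1 "min (real (g d)) (real (h d))" "real (g d)"]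
        frac_le[of 1 1 "min (real (g d)) (real (h d))" "real (h d)"] by simp
    then have "(1 / real (g d) + 1 / real (h d)) * ((ve + vg) * (E / mL d)\<^sup>2)
        \<le> 2 / min (real (g d)) (real (h d)) * ((ve + vg) * (E / mL d)\<^sup>2)"
      using nonneg by (intro mult_right_mono) auto
    also have "\<dots> = C * \<bar>1 / (min (real (g d) powr (1 - 0)) (real (h d) powr (1 - 0)) * (mL d)\<^sup>2)\<bar>"
      using g' h' by (simp add: C_def power_divide abs_of_pos)
    finally have "(1 / real (g d) + 1 / real (h d)) * (ve + vg) * (E / mL d)\<^sup>2
        \<le> C * \<bar>1 / (min (real (g d) powr (1 - 0)) (real (h d) powr (1 - 0)) * (mL d)\<^sup>2)\<bar>"
      by (simp only: mult.assoc)
    note bound = order_trans[OF inverse_cov_mat_remainder_bound this]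
    show ?case
    proof (intro conjI allI impI)
      show "the (mat_inverse (cov_mat va vb vg ve (g d) (h d) (m d))) - inv_leading vg ve (g d) (h d) (m d)
          \<in> carrier_mat (num_obs (g d) (h d) (m d)) (num_obs (g d) (h d) (m d))"
        by (rule minus_carrier_mat[OF inv_leading_carrier])
    qed (rule bound; use nonneg m elim in blast)
  qed
  then show ?thesis
    unfolding inverse_expansion_def bigo_mat_def mL_def by (intro CollectI exI)
qed

theorem theorem3:
  fixes F :: "'d filter"
    and g h :: "'d \<Rightarrow> nat"
    and m :: "'d \<Rightarrow> nat \<Rightarrow> nat \<Rightarrow> nat"
    and va vb vg ve :: real
  assumes "va \<ge> 0" and "vb \<ge> 0" and "vg \<ge> 0" and "ve > 0"
    and "\<And>d. g d \<ge> 1" and "\<And>d. h d \<ge> 1"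
    and "\<And>d i j. i < g d \<Longrightarrow> j < h d \<Longrightarrow> m d i j \<ge> 1"
    and "filterlim g at_top F" and "filterlim h at_top F"
    and "vg > 0 \<or> (\<exists>B. \<forall>\<^sub>F d in F. min_cell (g d) (h d) (m d) \<le> B)"
  shows "(\<forall>d. invertible_mat (cov_mat va vb vg ve (g d) (h d) (m d)))
    \<and> (\<exists>\<epsilon>. 0 \<le> \<epsilon> \<and> \<epsilon> < 1 \<and> inverse_expansion F va vb vg ve g h m \<epsilon>)
    \<and> ((\<forall>\<^sub>F d in F.
          (vg > 0 \<and> ve / (2 * (real (min_cell (g d) (h d) (m d)))\<^sup>2 * vg) \<le> 1)
          \<or> (\<exists>c. \<forall>i<g d. \<forall>j<h d. m d i j = c))
        \<longrightarrow> inverse_expansion F va vb vg ve g h m 0)"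
proof -
  \<comment> \<open>Invertibility ensures that the expansion speaks of an actual inverse.\<close>
  have "invertible_mat (cov_mat va vb vg ve (g d) (h d) (m d))" for d
    using inverse_cov_mat[OF assms(1-4), of "g d" "h d" "m d"] assms(7)
      cov_mat_carrier[of va vb vg ve "g d" "h d" "m d"]
    unfolding invertible_mat_def inverts_mat_def by (metis carrier_matD square_mat.elims(3))
  \<comment> \<open>The expansion with exponent 0 supplies both the witness and the last
    conjunct.\<close>
  moreover have "inverse_expansion F va vb vg ve g h m 0"
    by (rule inverse_expansion_zero[OF assms(1-7,10)])
  ultimately show ?thesis
    by (intro conjI impI allI exI[of _ "0::real"]) auto
qed

end
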